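(* Let $S$ be a finite set, let $S_1,\dots,S_n\subseteq S$, and let $k\ge 2$ be an integer. For a partition of $\{S_1,\dots,S_n\}$ into $k$ (possibly empty) covers $c_1,\dots,c_k$, define its coverage as $\sum_{i=1}^k \left|\bigcup_{S_j\in c_i} S_j\right|$, and let $\mathrm{OPT}$ be the maximum coverage over all such partitions. Consider the randomized algorithm that assigns each subset $S_j$ independently to a cover $c_i$ with $i$ chosen uniformly at random from $\{1,\dots,k\}$. Then the expected coverage of the resulting partition is at least $\left(1-\frac{1}{e}\right)\mathrm{OPT}$.
   Context: This is the SET K-COVER problem: given $S$, the collection $\{S_j\}_{j=1}^n$ and $k$, find a partition of the subsets into $k$ covers maximizing the coverage $\sum_{i=1}^k |\bigcup_{S_j\in c_i} S_j|$, i.e., the total over elements $v\in S$ of the number of covers containing a subset that contains $v$. *)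

theory Defs
  imports "HOL-Probability.Probability" "HOL-Library.Disjoint_Sets"
begin

text \<open>
  The collection is an indexed family \<open>T 1, \<dots>, T n\<close>, so that members with equal value
  are still assigned separately. A cover is the set of indices of its members.
\<close>

definition cover_partitions :: "nat \<Rightarrow> nat \<Rightarrow> (nat \<Rightarrow> nat set) set" where
  "cover_partitions n k =
     {c \<in> extensional {1..k}. disjoint_family_on c {1..k} \<and> (\<Union>i\<in>{1..k}. c i) = {1..n}}"

definition coverage :: "(nat \<Rightarrow> 'a set) \<Rightarrow> nat \<Rightarrow> (nat \<Rightarrow> nat set) \<Rightarrow> nat" where
  "coverage T k c = (\<Sum>i\<in>{1..k}. card (\<Union>j\<in>c i. T j))"

definition opt_coverage :: "(nat \<Rightarrow> 'a set) \<Rightarrow> nat \<Rightarrow> nat \<Rightarrow> nat" where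
  "opt_coverage T n k = Max (coverage T k ` cover_partitions n k)"

definition induced_covers :: "nat \<Rightarrow> nat \<Rightarrow> (nat \<Rightarrow> nat) \<Rightarrow> nat \<Rightarrow> nat set" where
  "induced_covers n k f = (\<lambda>i\<in>{1..k}. {j \<in> {1..n}. f j = i})"

text \<open>
  \<^const>\<open>Pi_pmf\<close> is the product distribution: the values at the indices \<open>1, \<dots>, n\<close> are
  independent, and the value at every other index is the irrelevant default \<open>0\<close>.
\<close>

definition random_covers :: "nat \<Rightarrow> nat \<Rightarrow> (nat \<Rightarrow> nat set) pmf" where
  "random_covers n k =
     map_pmf (induced_covers n k) (Pi_pmf {1..n} 0 (\<lambda>_. pmf_of_set {1..k}))"

lemma finite_cover_partitions: "finite (cover_partitions n k)"
proof (rule finite_subset)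
  show "cover_partitions n k \<subseteq> {1..k} \<rightarrow>\<^sub>E Pow {1..n}"
    by (auto simp: cover_partitions_def PiE_def)
qed (auto intro: finite_PiE)

lemma induced_covers_in_cover_partitions:
  assumes "\<And>j. j \<in> {1..n} \<Longrightarrow> f j \<in> {1..k}"
  shows "induced_covers n k f \<in> cover_partitions n k"
  using assms by (fastforce simp: induced_covers_def cover_partitions_def disjoint_family_on_def)

lemma cover_partitions_nonempty:
  assumes "k \<ge> 1"
  shows "cover_partitions n k \<noteq> {}"
  using induced_covers_in_cover_partitions[of n "\<lambda>_. 1" k] assms by auto

lemma set_pmf_random_covers:
  assumes "k \<ge> 1"
  shows "set_pmf (random_covers n k) \<subseteq> cover_partitions n k"
  using assms
  by (auto simp: random_covers_def set_Pi_pmf PiE_dflt_def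
           intro!: induced_covers_in_cover_partitions)

end

theory Submission
  imports Defs
begin

text \<open>
  Count element by element. If \<open>v\<close> lies in \<open>m\<close> of the subsets, every partition covers
  \<open>v\<close> at most \<open>min k m\<close> times, while the random one covers it \<open>k (1 - (1 - 1/k)^m)\<close>
  times on average. With \<open>x = min k m / k\<close>, which lies in \<open>[0, 1]\<close>, convexity of \<open>exp\<close> gives
  \<open>(1 - 1/k)^m \<le> exp (- m/k) \<le> exp (- x) \<le> 1 - (1 - 1/e) x\<close>,
  so the ratio is at least \<open>1 - 1/e\<close> for each element.
\<close>

text \<open>Double counting of the pairs of a cover and an element it covers: \<open>S\<close>
  contains every union, so each cardinality is a sum of indicators over \<open>S\<close>, and the
  two sums are swapped.\<close>

lemma coverage_eq_double_sum:
  assumes "finite S" "\<And>i. i \<in> {1..k} \<Longrightarrow> (\<Union>j\<in>c i. T j) \<subseteq> S"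
  shows "coverage T k c = (\<Sum>v\<in>S. card {i \<in> {1..k}. \<exists>j\<in>c i. v \<in> T j})"
proof -
  have "coverage T k c = (\<Sum>i\<in>{1..k}. \<Sum>v\<in>S. of_bool (\<exists>j\<in>c i. v \<in> T j))"
    unfolding coverage_def
  proof (intro sum.cong refl)
    fix i assume "i \<in> {1..k}"
    then have "(\<Union>j\<in>c i. T j) = S \<inter> {v. \<exists>j\<in>c i. v \<in> T j}"
      using assms(2) by blast
    then show "card (\<Union>j\<in>c i. T j) = (\<Sum>v\<in>S. of_bool (\<exists>j\<in>c i. v \<in> T j))"
      using assms(1) by (simp add: sum_of_bool_eq)
  qed
  also have "\<dots> = (\<Sum>v\<in>S. \<Sum>i\<in>{1..k}. of_bool (\<exists>j\<in>c i. v \<in> T j))"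
    by (rule sum.swap)
  also have "\<dots> = (\<Sum>v\<in>S. card {i \<in> {1..k}. \<exists>j\<in>c i. v \<in> T j})"
    by (simp add: sum_of_bool_eq Int_def)
  finally show ?thesis .
qed

text \<open>Each cover that covers \<open>v\<close> has a member \<open>g i\<close> witnessing this.
  The covers are disjoint, so \<open>g\<close> is injective into the indices of subsets containing
  \<open>v\<close>. The bound \<open>k\<close> just counts all covers.\<close>

lemma card_covers_containing_le:
  assumes "c \<in> cover_partitions n k"
  shows "card {i \<in> {1..k}. \<exists>j\<in>c i. v \<in> T j} \<le> min k (card {j \<in> {1..n}. v \<in> T j})"
proof -
  let ?I = "{i \<in> {1..k}. \<exists>j\<in>c i. v \<in> T j}"
  have sub: "j \<in> {1..n}" if "i \<in> {1..k}" "j \<in> c i" for i j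
    using assms that unfolding cover_partitions_def by blast
  have "\<forall>i\<in>?I. \<exists>j. j \<in> c i \<and> v \<in> T j" by blast
  then obtain g where g: "\<And>i. i \<in> ?I \<Longrightarrow> g i \<in> c i" "\<And>i. i \<in> ?I \<Longrightarrow> v \<in> T (g i)"
    using bchoice[of ?I "\<lambda>i j. j \<in> c i \<and> v \<in> T j"] by blast
  have "inj_on g ?I"
  proof (rule inj_onI, rule ccontr)
    fix a b assume ab: "a \<in> ?I" "b \<in> ?I" "g a = g b" "a \<noteq> b"
    have "c a \<inter> c b = {}"
      using assms ab(1,2,4) by (simp add: cover_partitions_def disjoint_family_on_def)
    then show False
      using g(1)[OF ab(1)] g(1)[OF ab(2)] ab(3) by auto
  qed
  moreover have "g ` ?I \<subseteq> {j \<in> {1..n}. v \<in> T j}"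
    using g sub by blast
  ultimately have "card ?I \<le> card {j \<in> {1..n}. v \<in> T j}"
    by (intro card_inj_on_le) auto
  moreover have "card ?I \<le> card {1..k}"
    by (intro card_mono) auto
  ultimately show ?thesis by simp
qed

text \<open>Cover \<open>i\<close> misses \<open>v\<close> exactly when no subset containing
  \<open>v\<close> is assigned to \<open>i\<close>. These assignments are independent, and each
  avoids \<open>i\<close> with probability \<open>1 - 1 / k\<close>.\<close>

lemma prob_cover_contains:
  fixes i k n :: nat
  assumes "i \<in> {1..k}"
  shows "measure_pmf.prob (Pi_pmf {1..n} 0 (\<lambda>_. pmf_of_set {1..k}))
           {f. \<exists>j\<in>{1..n}. f j = i \<and> v \<in> T j}
         = 1 - (1 - 1 / real k) ^ card {j \<in> {1..n}. v \<in> T j}"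
proof -
  let ?P = "Pi_pmf {1..n} (0::nat) (\<lambda>_. pmf_of_set {1..k})"
  \<comment> \<open>The values permitted at index \<open>j\<close> if cover \<open>i\<close> is to
    miss \<open>v\<close>. With \<open>UNIV\<close> at the unconstrained indices, this event is a
    product set whose probability factorizes.\<close>
  let ?B = "\<lambda>j. if v \<in> T j then - {i} else UNIV"
  have k: "k > 0" "{1..k} \<noteq> {}" using assms by auto
  have one: "measure_pmf.prob (pmf_of_set {1..k}) (- {i}) = 1 - 1 / real k"
  proof -
    have "measure_pmf.prob (pmf_of_set {1..k}) (- {i})
        = 1 - measure_pmf.prob (pmf_of_set {1..k}) {i}"
      using measure_pmf.prob_compl[of "{i}" "pmf_of_set {1..k}"] by (simp add: Compl_eq_Diff_UNIV)
    then show ?thesis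
      using k assms by (simp add: measure_pmf_single)
  qed
  have "{f. \<exists>j\<in>{1..n}. f j = i \<and> v \<in> T j} = UNIV - Pi {1..n} ?B"
    by (auto simp: Pi_def split: if_splits)
  then have "measure_pmf.prob ?P {f. \<exists>j\<in>{1..n}. f j = i \<and> v \<in> T j}
      = 1 - measure_pmf.prob ?P (Pi {1..n} ?B)"
    using measure_pmf.prob_compl[of "Pi {1..n} ?B" ?P] by simp
  also have "measure_pmf.prob ?P (Pi {1..n} ?B)
      = (\<Prod>j\<in>{1..n}. measure_pmf.prob (pmf_of_set {1..k}) (?B j))"
    by (rule measure_Pi_pmf_Pi) auto
  also have "\<dots> = (\<Prod>j\<in>{1..n}. if v \<in> T j then 1 - 1 / real k else 1)"
    by (intro prod.cong refl) (use one in auto)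
  also have "\<dots> = (1 - 1 / real k) ^ card {j \<in> {1..n}. v \<in> T j}"
    by (simp add: prod.If_cases Int_def)
  finally show ?thesis .
qed

lemma random_assignment_factor_bound:
  assumes "k \<ge> 1"
  shows "(1 - 1 / exp 1) * real (min k m) \<le> real k * (1 - (1 - 1 / real k) ^ m)"
proof -
  define x where "x = real (min k m) / real k"
  have x: "0 \<le> x" "x \<le> 1" "x \<le> real m / real k"
    using assms by (auto simp: x_def divide_simps)
  have "1 - 1 / real k \<le> exp (- (1 / real k))"
    using exp_ge_add_one_self[of "- (1 / real k)"] by simp
  then have "(1 - 1 / real k) ^ m \<le> exp (- (1 / real k)) ^ m"
    using assms by (intro power_mono) auto
  also have "\<dots> = exp (- (real m / real k))"
    by (simp flip: exp_of_nat_mult)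
  also have "\<dots> \<le> exp (- x)" using x by simp
  \<comment> \<open>On [-1, 0] the graph of \<open>exp\<close> lies below its chord, evaluated here
    at \<open>-x = (1 - x) * 0 + x * (-1)\<close>.\<close>
  also have "\<dots> \<le> (1 - x) * exp 0 + x * exp (- 1)"
    using convex_onD[OF exp_convex, of x 0 "-1"] x by simp
  finally have "(1 - 1 / exp 1) * x \<le> 1 - (1 - 1 / real k) ^ m"
    by (simp add: algebra_simps exp_minus divide_inverse)
  then have "real k * ((1 - 1 / exp 1) * x) \<le> real k * (1 - (1 - 1 / real k) ^ m)"
    by (rule mult_left_mono) simp
  moreover have "real (min k m) = real k * x"
    using assms by (simp add: x_def)
  ultimately show ?thesis by (simp only: mult.left_commute)
qed

text \<open>Linearity of expectation over the pairs of an element \<open>v\<close> and a cover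
  \<open>i\<close>. The probability for a pair does not depend on \<open>i\<close>, so summing over
  the covers gives the factor \<open>k\<close>.\<close>

lemma expectation_coverage:
  assumes "finite S" and "\<And>j. j \<in> {1..n} \<Longrightarrow> T j \<subseteq> S" and "k \<ge> 1"
  shows "measure_pmf.expectation (random_covers n k) (\<lambda>c. real (coverage T k c))
         = (\<Sum>v\<in>S. real k * (1 - (1 - 1 / real k) ^ card {j \<in> {1..n}. v \<in> T j}))"
proof -
  let ?P = "Pi_pmf {1..n} (0::nat) (\<lambda>_. pmf_of_set {1..k})"
  let ?E = "\<lambda>v i. {f. \<exists>j\<in>{1..n}. f j = i \<and> v \<in> T j}"
  have "real (coverage T k (induced_covers n k f))
      = (\<Sum>v\<in>S. \<Sum>i\<in>{1..k}. indicator (?E v i) f)" for f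
  proof -
    have "coverage T k (induced_covers n k f)
        = (\<Sum>v\<in>S. card {i \<in> {1..k}. \<exists>j\<in>induced_covers n k f i. v \<in> T j})"
      using assms(2) by (intro coverage_eq_double_sum assms(1)) (auto simp: induced_covers_def)
    \<comment> \<open>For fixed \<open>f\<close>, membership of \<open>i\<close> in the counted set
      is recast as membership of \<open>f\<close> in an event, so that the count becomes a sum of
      indicators of events.\<close>
    also have "\<dots> = (\<Sum>v\<in>S. card ({1..k} \<inter> {i. f \<in> ?E v i}))"
      by (intro sum.cong refl arg_cong[where f = card]) (auto simp: induced_covers_def)
    finally show ?thesis
      by (simp add: indicator_def sum_of_bool_eq)
  qed
  then have "measure_pmf.expectation (random_covers n k) (\<lambda>c. real (coverage T k c))
      = measure_pmf.expectation ?P (\<lambda>f. \<Sum>v\<in>S. \<Sum>i\<in>{1..k}. indicator (?E v i) f)"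
    by (simp add: random_covers_def)
  also have "\<dots> = (\<Sum>v\<in>S. \<Sum>i\<in>{1..k}. measure_pmf.prob ?P (?E v i))"
    by (simp add: measure_pmf.emeasure_eq_measure)
  also have "\<dots> = (\<Sum>v\<in>S. \<Sum>i\<in>{1..k}. 1 - (1 - 1 / real k) ^ card {j \<in> {1..n}. v \<in> T j})"
    by (intro sum.cong refl prob_cover_contains)
  finally show ?thesis by simp
qed

theorem theorem1:
  fixes S :: "'a set" and T :: "nat \<Rightarrow> 'a set" and n k :: nat
  assumes "finite S"
    and "\<And>j. j \<in> {1..n} \<Longrightarrow> T j \<subseteq> S"
    and "k \<ge> 2"
  shows "measure_pmf.expectation (random_covers n k) (\<lambda>c. real (coverage T k c))
           \<ge> (1 - 1 / exp 1) * real (opt_coverage T n k)"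
proof -
  have k: "k \<ge> 1" using assms(3) by simp
  let ?m = "\<lambda>v. card {j \<in> {1..n}. v \<in> T j}"
  \<comment> \<open>The maximum over a finite nonempty set is attained, so the optimum can be
    bounded through one optimal partition \<open>c\<close>.\<close>
  have "opt_coverage T n k \<in> coverage T k ` cover_partitions n k"
    unfolding opt_coverage_def
    using cover_partitions_nonempty[OF k] finite_cover_partitions by (intro Max_in) auto
  then obtain c where c: "c \<in> cover_partitions n k" "opt_coverage T n k = coverage T k c"
    by auto
  have "(\<Union>j\<in>c i. T j) \<subseteq> S" if "i \<in> {1..k}" for i
  proof -
    have "c i \<subseteq> {1..n}" using c(1) that unfolding cover_partitions_def by blast
    then show ?thesis using assms(2) by blast
  qed
  then have "coverage T k c = (\<Sum>v\<in>S. card {i \<in> {1..k}. \<exists>j\<in>c i. v \<in> T j})"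
    by (rule coverage_eq_double_sum[OF assms(1)])
  also have "\<dots> \<le> (\<Sum>v\<in>S. min k (?m v))"
    by (intro sum_mono card_covers_containing_le c(1))
  finally have "real (opt_coverage T n k) \<le> (\<Sum>v\<in>S. real (min k (?m v)))"
    unfolding c(2) by (simp flip: of_nat_sum)
  then have "(1 - 1 / exp 1) * real (opt_coverage T n k)
      \<le> (1 - 1 / exp 1) * (\<Sum>v\<in>S. real (min k (?m v)))"
    by (intro mult_left_mono) auto
  \<comment> \<open>Both sides are now sums over \<open>S\<close>, so the single-element bound
    applies termwise with \<open>m = ?m v\<close>.\<close>
  also have "\<dots> \<le> (\<Sum>v\<in>S. real k * (1 - (1 - 1 / real k) ^ ?m v))"
    unfolding sum_distrib_left by (intro sum_mono random_assignment_factor_bound k)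
  also have "\<dots> = measure_pmf.expectation (random_covers n k) (\<lambda>c. real (coverage T k c))"
    using expectation_coverage[OF assms(1,2) k] by simp
  finally show ?thesis .
qed

end
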